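(* Let $k\ge 2$, let $I$ be a finite set, let $X\subseteq Y_2^{(k)}\times I^2$ and let $Z$ be its complement, i.e. $X\sqcup Z=Y_2^{(k)}\times I^2$. Then the following identity of formal power series holds: $$g^{(k)}(Z,f^{(k)}(X,t))=t.$$
   Context: $Y_n^{(k)}$ denotes the set of planar rooted trees with $n$ internal vertices in which every internal vertex has exactly $k$ (ordered) children (called "valence $k$"); such a tree has $(k-1)n+1$ leaves. $Y_n^{(k)}\times I^n$ is the set of such trees whose $n$ internal vertices are labelled by elements of $I$ (labels need not be distinct). $Y_2^{(k)}$ has $k$ elements, according to which child of the root vertex is the other vertex. A pair of adjacent internal vertices (a vertex and one of its children) in a labelled tree determines a labelled subtree in $Y_2^{(k)}\times I^2$, called a local pattern. For $X\subseteq Y_2^{(k)}\times I^2$, $X_n\subseteq Y_n^{(k)}\times I^n$ is the set of labelled trees all of whose local patterns belong to $X$; by convention $X_0=Y_0^{(k)}\times I^0$ (one element, the tree with a single leaf) and $X_1=Y_1^{(k)}\times I$. The sets $Z_n$ are defined in the same way from $Z$. The series are $$f^{(k)}(X,t)=\sum_{n\ge0}(-1)^{n+1}(\#X_n)\,t^{(k-1)n+1},\qquad g^{(k)}(Z,t)=-\sum_{n\ge0}(-1)^{(k+1)n}(\#Z_n)\,t^{(k-1)n+1}.$$ *)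

theory Defs
  imports "HOL-Computational_Algebra.Formal_Power_Series"
begin

text \<open>Planar rooted trees whose internal vertices carry labels; a leaf carries none.\<close>

datatype (labels: 'a) ltree = Leaf | Node 'a "'a ltree list"

fun internal_vertices :: "'a ltree \<Rightarrow> nat" where
  "internal_vertices Leaf = 0"
| "internal_vertices (Node a ts) = Suc (sum_list (map internal_vertices ts))"

fun valence :: "nat \<Rightarrow> 'a ltree \<Rightarrow> bool" where
  "valence k Leaf = True"
| "valence k (Node a ts) = (length ts = k \<and> (\<forall>t\<in>set ts. valence k t))"

text \<open>The set \<open>Y\<^sub>n\<^sup>(\<^sup>k\<^sup>) \<times> I\<^sup>n\<close>: a tree and the family of its labels are kept
  together in a single labelled tree.\<close>

definition labelled_trees :: "nat \<Rightarrow> nat \<Rightarrow> 'a set \<Rightarrow> 'a ltree set" where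
  "labelled_trees k n I = {t. valence k t \<and> internal_vertices t = n \<and> labels t \<subseteq> I}"

text \<open>\<open>adjacent_pattern a m i b l\<close> has a root labelled \<open>a\<close> with \<open>m\<close> children, the \<open>i\<close>-th of
  which (counted from 0) is an internal vertex labelled \<open>b\<close> with \<open>l\<close> children; all other
  children are leaves.\<close>

definition adjacent_pattern :: "'a \<Rightarrow> nat \<Rightarrow> nat \<Rightarrow> 'a \<Rightarrow> nat \<Rightarrow> 'a ltree" where
  "adjacent_pattern a m i b l = Node a ((replicate m Leaf)[i := Node b (replicate l Leaf)])"

fun local_patterns :: "'a ltree \<Rightarrow> 'a ltree set" where
  "local_patterns Leaf = {}"
| "local_patterns (Node a ts) =
     {adjacent_pattern a (length ts) i b (length us) | i b us. i < length ts \<and> ts ! i = Node b us}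
     \<union> (\<Union>t\<in>set ts. local_patterns t)"

text \<open>The set \<open>X\<^sub>n\<close>. For \<open>n \<le> 1\<close> there are no local patterns, so every labelled tree is
  included, in accordance with the convention for \<open>X\<^sub>0\<close> and \<open>X\<^sub>1\<close>.\<close>

definition trees_with_patterns ::
    "nat \<Rightarrow> 'a set \<Rightarrow> 'a ltree set \<Rightarrow> nat \<Rightarrow> 'a ltree set" where
  "trees_with_patterns k I X n = {t \<in> labelled_trees k n I. local_patterns t \<subseteq> X}"

text \<open>\<open>lacunary_series k c\<close> is the series \<open>\<Sum>n. c n * t ^ ((k - 1) * n + 1)\<close>, given by its
  coefficients. It is meant for \<open>k \<ge> 2\<close>, where at most one \<open>n\<close> contributes to each
  coefficient.\<close>

definition lacunary_series :: "nat \<Rightarrow> (nat \<Rightarrow> int) \<Rightarrow> int fps" where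
  "lacunary_series k c = Abs_fps (\<lambda>m. \<Sum>n | (k - 1) * n + 1 = m. c n)"

definition f_series :: "nat \<Rightarrow> 'a set \<Rightarrow> 'a ltree set \<Rightarrow> int fps" where
  "f_series k I X =
     lacunary_series k (\<lambda>n. (-1) ^ (n + 1) * int (card (trees_with_patterns k I X n)))"

definition g_series :: "nat \<Rightarrow> 'a set \<Rightarrow> 'a ltree set \<Rightarrow> int fps" where
  "g_series k I Z =
     - lacunary_series k (\<lambda>n. (-1) ^ ((k + 1) * n) * int (card (trees_with_patterns k I Z n)))"

end

theory Submission imports Defs "HOL-Computational_Algebra.Formal_Laurent_Series"
begin

text \<open>
  Write \<open>h = - f_series k I X\<close> and \<open>G(s) = \<Sum>n. #Z\<^sub>n s ^ ((k - 1) n + 1)\<close>. Since \<open>h\<close> has only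
  exponents \<open>(k - 1) n + 1\<close>, the signs in the definition of \<open>g\<close> are exactly those that turn
  \<open>g(f(t)) = t\<close> into \<open>G(h(t)) = t\<close>.

  Split both series by the label \<open>a\<close> of the root: \<open>h = t + (\<Sum>a. h\<^sub>a)\<close> and
  \<open>G(s) = s + (\<Sum>a. G\<^sub>a(s))\<close>. Let \<open>X\<^sub>a\<^sub>i\<close> be the set of labels \<open>b\<close> such that an edge from a vertex
  \<open>a\<close> to its \<open>i\<close>-th child \<open>b\<close> has its pattern in \<open>X\<close>; the sets \<open>Z\<^sub>a\<^sub>i\<close> are the complements in \<open>I\<close>.
  Removing the root of a tree leaves \<open>k\<close> independent subtrees with prescribed admissible roots
  (\<open>root_series_eq\<close>), hence
  \<open>- h\<^sub>a = (\<Prod>i<k. t + (\<Sum>b\<in>X\<^sub>a\<^sub>i. h\<^sub>b))\<close> and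
  \<open>G\<^sub>a(h) = (\<Prod>i<k. h + (\<Sum>b\<in>Z\<^sub>a\<^sub>i. G\<^sub>b(h)))\<close>.
  Because \<open>h = t + (\<Sum>b\<in>X\<^sub>a\<^sub>i. h\<^sub>b) + (\<Sum>b\<in>Z\<^sub>a\<^sub>i. h\<^sub>b)\<close>, the series \<open>- h\<^sub>a\<close> solve the second system too.
  As \<open>k \<ge> 2\<close>, this system has at most one solution without constant terms
  (\<open>product_system_unique\<close>), so \<open>G\<^sub>a(h) = - h\<^sub>a\<close> and
  \<open>G(h) = h - (\<Sum>a. h\<^sub>a) = t\<close>.
\<close>

unbundle fps_syntax

section \<open>Generating series of graded sets\<close>

definition finite_fibres :: "('b \<Rightarrow> nat) \<Rightarrow> 'b set \<Rightarrow> bool" where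
  "finite_fibres sz S \<longleftrightarrow> (\<forall>n. finite {x\<in>S. sz x = n})"

text \<open>The ordinary generating series of \<open>S\<close> graded by \<open>sz\<close>. An infinite fibre contributes 0;
  the series is meant for \<open>finite_fibres sz S\<close>.\<close>

definition gen_series :: "('b \<Rightarrow> nat) \<Rightarrow> 'b set \<Rightarrow> int fps" where
  "gen_series sz S = Abs_fps (\<lambda>n. int (card {x\<in>S. sz x = n}))"

lemma gen_series_nth [simp]: "gen_series sz S $ n = int (card {x\<in>S. sz x = n})"
  by (simp add: gen_series_def)

lemma finite_fibres_subset: "finite_fibres sz T \<Longrightarrow> S \<subseteq> T \<Longrightarrow> finite_fibres sz S"
  unfolding finite_fibres_def by (blast intro: finite_subset [rotated])

lemma gen_series_singleton: "gen_series sz {x} = fps_X ^ sz x"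
proof (rule fps_ext)
  fix n
  have "{y\<in>{x}. sz y = n} = (if sz x = n then {x} else {})" by auto
  then show "gen_series sz {x} $ n = fps_X ^ sz x $ n" by auto
qed

lemma gen_series_Un:
  assumes "finite_fibres sz A" "finite_fibres sz B" "A \<inter> B = {}"
  shows "gen_series sz (A \<union> B) = gen_series sz A + gen_series sz B"
proof (rule fps_ext)
  fix n
  have "{x\<in>A \<union> B. sz x = n} = {x\<in>A. sz x = n} \<union> {x\<in>B. sz x = n}" by auto
  moreover have "card ({x\<in>A. sz x = n} \<union> {x\<in>B. sz x = n}) =
      card {x\<in>A. sz x = n} + card {x\<in>B. sz x = n}"
    using assms by (intro card_Un_disjoint) (auto simp: finite_fibres_def)
  ultimately show "gen_series sz (A \<union> B) $ n = (gen_series sz A + gen_series sz B) $ n"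
    by simp
qed

lemma gen_series_UNION:
  assumes "finite J" "\<And>j. j \<in> J \<Longrightarrow> finite_fibres sz (A j)"
    and "\<And>i j. i \<in> J \<Longrightarrow> j \<in> J \<Longrightarrow> i \<noteq> j \<Longrightarrow> A i \<inter> A j = {}"
  shows "gen_series sz (\<Union>j\<in>J. A j) = (\<Sum>j\<in>J. gen_series sz (A j))"
proof (rule fps_ext)
  fix n
  have "{x\<in>\<Union>j\<in>J. A j. sz x = n} = (\<Union>j\<in>J. {x\<in>A j. sz x = n})" by auto
  moreover have "card (\<Union>j\<in>J. {x\<in>A j. sz x = n}) = (\<Sum>j\<in>J. card {x\<in>A j. sz x = n})"
    using assms by (intro card_UN_disjoint) (fastforce simp: finite_fibres_def)+
  ultimately show "gen_series sz (\<Union>j\<in>J. A j) $ n = (\<Sum>j\<in>J. gen_series sz (A j)) $ n"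
    by (simp add: fps_sum_nth)
qed

lemma graded_image:
  assumes "inj_on f S" "\<And>x. x \<in> S \<Longrightarrow> sz (f x) = sz' x"
  shows "gen_series sz (f ` S) = gen_series sz' S"
    and "finite_fibres sz (f ` S) \<longleftrightarrow> finite_fibres sz' S"
proof -
  have fibre: "{y\<in>f ` S. sz y = n} = f ` {x\<in>S. sz' x = n}" for n
    using assms(2) by auto
  have inj: "inj_on f {x\<in>S. sz' x = n}" for n
    using assms(1) by (rule inj_on_subset) auto
  show "gen_series sz (f ` S) = gen_series sz' S"
    by (rule fps_ext) (simp add: fibre card_image [OF inj])
  show "finite_fibres sz (f ` S) \<longleftrightarrow> finite_fibres sz' S"
    by (simp add: finite_fibres_def fibre finite_image_iff [OF inj])
qed

lemma graded_Times:
  assumes "finite_fibres u A" "finite_fibres v B"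
  shows "gen_series (\<lambda>(x, y). u x + v y) (A \<times> B) = gen_series u A * gen_series v B"
    and "finite_fibres (\<lambda>(x, y). u x + v y) (A \<times> B)"
proof -
  have fibre: "{p\<in>A \<times> B. (case p of (x, y) \<Rightarrow> u x + v y) = n} =
      (\<Union>i\<in>{0..n}. {x\<in>A. u x = i} \<times> {y\<in>B. v y = n - i})" for n
    by auto
  show "gen_series (\<lambda>(x, y). u x + v y) (A \<times> B) = gen_series u A * gen_series v B"
  proof (rule fps_ext)
    fix n
    have "card (\<Union>i\<in>{0..n}. {x\<in>A. u x = i} \<times> {y\<in>B. v y = n - i}) =
        (\<Sum>i\<in>{0..n}. card ({x\<in>A. u x = i} \<times> {y\<in>B. v y = n - i}))"
      using assms by (intro card_UN_disjoint) (auto simp: finite_fibres_def)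
    then show "gen_series (\<lambda>(x, y). u x + v y) (A \<times> B) $ n = (gen_series u A * gen_series v B) $ n"
      by (simp add: fibre fps_mult_nth card_cartesian_product)
  qed
  show "finite_fibres (\<lambda>(x, y). u x + v y) (A \<times> B)"
    unfolding finite_fibres_def fibre using assms by (auto simp: finite_fibres_def)
qed

lemma mem_listset_iff:
  "xs \<in> listset As \<longleftrightarrow> length xs = length As \<and> (\<forall>i<length As. xs ! i \<in> As ! i)"
proof (induction As arbitrary: xs)
  case (Cons A As)
  show ?case
    by (cases xs) (auto simp: set_Cons_def Cons.IH All_less_Suc2)
qed auto

lemma graded_listset:
  assumes "\<And>A. A \<in> set As \<Longrightarrow> finite_fibres sz A"
  shows "gen_series (\<lambda>xs. sum_list (map sz xs)) (listset As) = prod_list (map (gen_series sz) As)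
    \<and> finite_fibres (\<lambda>xs. sum_list (map sz xs)) (listset As)"
  using assms
proof (induction As)
  case Nil
  show ?case by (auto simp: gen_series_singleton finite_fibres_def)
next
  case (Cons A As)
  let ?sz = "\<lambda>xs. sum_list (map sz xs)" and ?p = "\<lambda>(x, xs). x # xs"
  let ?sz' = "\<lambda>(x, xs). sz x + ?sz xs"
  have image: "listset (A # As) = ?p ` (A \<times> listset As)"
    by (auto simp: set_Cons_def)
  have "inj_on ?p (A \<times> listset As)" by (auto simp: inj_on_def)
  then have "gen_series ?sz (listset (A # As)) = gen_series ?sz' (A \<times> listset As)"
      "finite_fibres ?sz (listset (A # As)) \<longleftrightarrow> finite_fibres ?sz' (A \<times> listset As)"
    unfolding image by (intro graded_image; auto)+
  moreover have IH: "gen_series ?sz (listset As) = prod_list (map (gen_series sz) As)"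
      "finite_fibres ?sz (listset As)"
    using Cons by auto
  moreover have A: "finite_fibres sz A" using Cons.prems by simp
  ultimately show ?case
    using graded_Times [OF A IH(2)] IH(1) by (simp del: listset.simps)
qed

section \<open>Trees decomposed at the root\<close>

text \<open>The trees of all sizes with local patterns in \<open>X\<close>, and those among them whose root is
  an internal vertex labelled \<open>a\<close>.\<close>

definition pattern_trees :: "nat \<Rightarrow> 'a set \<Rightarrow> 'a ltree set \<Rightarrow> 'a ltree set" where
  "pattern_trees k I X = {t. valence k t \<and> labels t \<subseteq> I \<and> local_patterns t \<subseteq> X}"

definition rooted_trees :: "nat \<Rightarrow> 'a set \<Rightarrow> 'a ltree set \<Rightarrow> 'a \<Rightarrow> 'a ltree set" where
  "rooted_trees k I X a = {t \<in> pattern_trees k I X. \<exists>ts. t = Node a ts}"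

definition root_series :: "nat \<Rightarrow> 'a set \<Rightarrow> 'a ltree set \<Rightarrow> 'a \<Rightarrow> int fps" where
  "root_series k I X a = gen_series internal_vertices (rooted_trees k I X a)"

text \<open>The labels that \<open>X\<close> admits for the \<open>i\<close>-th child of a vertex labelled \<open>a\<close>.\<close>

definition child_labels :: "nat \<Rightarrow> 'a set \<Rightarrow> 'a ltree set \<Rightarrow> 'a \<Rightarrow> nat \<Rightarrow> 'a set" where
  "child_labels k I X a i = {b\<in>I. adjacent_pattern a k i b k \<in> X}"

lemma finite_bounded_trees:
  assumes "finite I"
  shows "finite {t. valence k t \<and> internal_vertices t \<le> n \<and> labels t \<subseteq> I}"
proof (induction n)
  case 0
  have "{t. valence k t \<and> internal_vertices t \<le> 0 \<and> labels t \<subseteq> I} \<subseteq> {Leaf}"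
  proof
    fix t assume "t \<in> {t. valence k t \<and> internal_vertices t \<le> 0 \<and> labels t \<subseteq> I}"
    then show "t \<in> {Leaf}" by (cases t) auto
  qed
  then show ?case by (rule finite_subset) simp
next
  case (Suc n)
  let ?T = "\<lambda>n. {t. valence k t \<and> internal_vertices t \<le> n \<and> labels t \<subseteq> I}"
  have "?T (Suc n) \<subseteq>
      {Leaf} \<union> (\<lambda>(a, ts). Node a ts) ` (I \<times> {ts. set ts \<subseteq> ?T n \<and> length ts = k})"
  proof
    fix t assume t: "t \<in> ?T (Suc n)"
    show "t \<in> {Leaf} \<union> (\<lambda>(a, ts). Node a ts) ` (I \<times> {ts. set ts \<subseteq> ?T n \<and> length ts = k})"
    proof (cases t)
      case (Node a ts)
      have "internal_vertices s \<le> n" if "s \<in> set ts" for s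
        using t Node member_le_sum_list [of "internal_vertices s" "map internal_vertices ts"] that
        by auto
      then have "(a, ts) \<in> I \<times> {ts. set ts \<subseteq> ?T n \<and> length ts = k}"
        using t Node by auto
      then show ?thesis unfolding Node by (intro UnI2 image_eqI [of _ _ "(a, ts)"]) auto
    qed simp
  qed
  moreover have "finite (I \<times> {ts. set ts \<subseteq> ?T n \<and> length ts = k})"
    using assms finite_lists_length_eq [OF Suc] by simp
  ultimately show ?case by (meson finite.emptyI finite.insertI finite_UnI finite_imageI finite_subset)
qed

lemma finite_fibres_pattern_trees:
  assumes "finite I"
  shows "finite_fibres internal_vertices (pattern_trees k I X)"
  unfolding finite_fibres_def
proof
  fix n
  show "finite {t \<in> pattern_trees k I X. internal_vertices t = n}"
    by (rule finite_subset [OF _ finite_bounded_trees [OF assms, of k n]])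
      (auto simp: pattern_trees_def)
qed

lemma finite_fibres_rooted_trees:
  "finite I \<Longrightarrow> finite_fibres internal_vertices (rooted_trees k I X a)"
  by (rule finite_fibres_subset [OF finite_fibres_pattern_trees]) (auto simp: rooted_trees_def)

lemma rooted_trees_disjoint: "a \<noteq> b \<Longrightarrow> rooted_trees k I X a \<inter> rooted_trees k I X b = {}"
  by (auto simp: rooted_trees_def)

lemma Leaf_in_pattern_trees: "Leaf \<in> pattern_trees k I X"
  by (simp add: pattern_trees_def)

lemma Node_in_pattern_trees:
  "Node a ts \<in> pattern_trees k I X \<longleftrightarrow>
     a \<in> I \<and> length ts = k \<and> (\<forall>i<k. ts ! i \<in> pattern_trees k I X) \<and>
     (\<forall>i<k. \<forall>b us. ts ! i = Node b us \<longrightarrow> adjacent_pattern a k i b (length us) \<in> X)"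
proof -
  have "labels (Node a ts) \<subseteq> I \<longleftrightarrow> a \<in> I \<and> (\<forall>t\<in>set ts. labels t \<subseteq> I)"
    by auto
  moreover have "local_patterns (Node a ts) \<subseteq> X \<longleftrightarrow>
      (\<forall>i<length ts. \<forall>b us. ts ! i = Node b us \<longrightarrow>
        adjacent_pattern a (length ts) i b (length us) \<in> X) \<and>
      (\<forall>t\<in>set ts. local_patterns t \<subseteq> X)"
    unfolding local_patterns.simps Un_subset_iff UN_subset_iff by blast
  ultimately show ?thesis
    unfolding pattern_trees_def mem_Collect_eq valence.simps all_set_conv_all_nth by blast
qed

lemma Node_in_pattern_trees_iff:
  "Node a ts \<in> pattern_trees k I X \<longleftrightarrow> a \<in> I \<and> length ts = k \<and>
     (\<forall>i<k. ts ! i \<in> {Leaf} \<union> (\<Union>b\<in>child_labels k I X a i. rooted_trees k I X b))"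
proof -
  have child: "t \<in> pattern_trees k I X \<and>
      (\<forall>b us. t = Node b us \<longrightarrow> adjacent_pattern a k i b (length us) \<in> X) \<longleftrightarrow>
      t \<in> {Leaf} \<union> (\<Union>b\<in>child_labels k I X a i. rooted_trees k I X b)" for t i
  proof (cases t)
    case (Node b us)
    have "t \<in> pattern_trees k I X \<Longrightarrow> length us = k \<and> b \<in> I"
      by (simp add: Node Node_in_pattern_trees)
    then show ?thesis
      unfolding rooted_trees_def child_labels_def Node by auto
  qed (simp add: Leaf_in_pattern_trees)
  show ?thesis by (simp only: Node_in_pattern_trees child [symmetric]) blast
qed

lemma rooted_trees_eq:
  assumes "a \<in> I"
  shows "rooted_trees k I X a = Node a ` listset
    (map (\<lambda>i. {Leaf} \<union> (\<Union>b\<in>child_labels k I X a i. rooted_trees k I X b)) [0..<k])"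
  using assms
  by (auto simp: rooted_trees_def [of k I X a] mem_listset_iff Node_in_pattern_trees_iff
      simp del: listset.simps)

lemma gen_series_Leaf_or_rooted:
  assumes "finite I" "J \<subseteq> I"
  shows "gen_series internal_vertices ({Leaf} \<union> (\<Union>b\<in>J. rooted_trees k I X b)) =
    1 + (\<Sum>b\<in>J. root_series k I X b)"
proof -
  let ?R = "\<Union>b\<in>J. rooted_trees k I X b"
  have "finite_fibres internal_vertices ?R"
    by (rule finite_fibres_subset [OF finite_fibres_pattern_trees [OF assms(1), of k X]])
      (auto simp: rooted_trees_def)
  then have "gen_series internal_vertices ({Leaf} \<union> ?R) = 1 + gen_series internal_vertices ?R"
    by (subst gen_series_Un) (auto simp: gen_series_singleton finite_fibres_def rooted_trees_def)
  also have "gen_series internal_vertices ?R = (\<Sum>b\<in>J. root_series k I X b)"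
    unfolding root_series_def
    using assms
    by (intro gen_series_UNION finite_fibres_rooted_trees rooted_trees_disjoint)
      (auto intro: finite_subset)
  finally show ?thesis .
qed

lemma pattern_trees_series:
  assumes "finite I"
  shows "gen_series internal_vertices (pattern_trees k I X) = 1 + (\<Sum>a\<in>I. root_series k I X a)"
proof -
  have "t \<in> {Leaf} \<union> (\<Union>a\<in>I. rooted_trees k I X a)" if t: "t \<in> pattern_trees k I X" for t
  proof (cases t)
    case (Node a ts)
    then have "a \<in> I" using t by (simp add: Node_in_pattern_trees)
    then show ?thesis using t Node by (auto simp: rooted_trees_def)
  qed simp
  then have "pattern_trees k I X = {Leaf} \<union> (\<Union>a\<in>I. rooted_trees k I X a)"
    using Leaf_in_pattern_trees by (fastforce simp: rooted_trees_def)
  then show ?thesis using gen_series_Leaf_or_rooted [OF assms order_refl] by simp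
qed

lemma root_series_eq:
  assumes "finite I" "a \<in> I"
  shows "root_series k I X a =
    fps_X * (\<Prod>i<k. 1 + (\<Sum>b\<in>child_labels k I X a i. root_series k I X b))"
proof -
  let ?sz = "\<lambda>ts. sum_list (map internal_vertices ts)"
  let ?C = "\<lambda>i. {Leaf} \<union> (\<Union>b\<in>child_labels k I X a i. rooted_trees k I X b)"
  let ?L = "listset (map ?C [0..<k])"
  have "finite_fibres internal_vertices (?C i)" for i
    by (rule finite_fibres_subset [OF finite_fibres_pattern_trees [OF assms(1), of k X]])
      (auto simp: rooted_trees_def Leaf_in_pattern_trees)
  then have L: "gen_series ?sz ?L = prod_list (map (gen_series internal_vertices) (map ?C [0..<k]))"
      "finite_fibres ?sz ?L"
    using graded_listset [of "map ?C [0..<k]" internal_vertices] by auto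
  have "root_series k I X a = gen_series (\<lambda>ts. Suc (?sz ts)) ?L"
    unfolding root_series_def rooted_trees_eq [OF assms(2)]
    by (rule graded_image(1)) (auto simp: inj_on_def)
  also have "\<dots> = fps_X * gen_series ?sz ?L"
  proof (rule fps_ext)
    fix n
    show "gen_series (\<lambda>ts. Suc (?sz ts)) ?L $ n = (fps_X * gen_series ?sz ?L) $ n"
      by (cases n) auto
  qed
  also have "gen_series ?sz ?L = (\<Prod>i<k. gen_series internal_vertices (?C i))"
    unfolding L(1) map_map prod.distinct_set_conv_list [OF distinct_upt, symmetric]
    by (simp add: atLeast0LessThan o_def)
  also have "\<dots> = (\<Prod>i<k. 1 + (\<Sum>b\<in>child_labels k I X a i. root_series k I X b))"
    by (intro prod.cong refl gen_series_Leaf_or_rooted assms) (auto simp: child_labels_def)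
  finally show ?thesis .
qed

section \<open>Uniqueness of solutions of the system at the roots\<close>

text \<open>If the factors are divisible by the variable, each factor after the first gains one order of
  agreement between the two products.\<close>

lemma fps_X_power_dvd_prod_diff:
  fixes p q :: "'b \<Rightarrow> int fps"
  assumes "finite A" "A \<noteq> {}"
    and "\<And>i. i \<in> A \<Longrightarrow> fps_X dvd p i" "\<And>i. i \<in> A \<Longrightarrow> fps_X dvd q i"
    and "\<And>i. i \<in> A \<Longrightarrow> fps_X ^ n dvd p i - q i"
  shows "fps_X ^ (n + (card A - 1)) dvd prod p A - prod q A"
  using assms
proof (induction rule: finite_ne_induct)
  case (insert x F)
  have "fps_X ^ card F dvd prod q F"
    using prod_dvd_prod [of F "\<lambda>_. fps_X :: int fps" q] insert.prems by simp
  then have "fps_X ^ n * fps_X ^ card F dvd (p x - q x) * prod q F"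
    using insert.prems by (intro mult_dvd_mono) auto
  moreover have "fps_X * fps_X ^ (n + (card F - 1)) dvd p x * (prod p F - prod q F)"
    using insert by (intro mult_dvd_mono) auto
  moreover have "card F > 0" using insert.hyps by (simp add: card_gt_0_iff)
  then have "n + card F = Suc (n + (card F - 1))" by simp
  ultimately have "fps_X ^ (n + card F) dvd p x * (prod p F - prod q F) + (p x - q x) * prod q F"
    by (metis dvd_add power_add power_Suc)
  also have "p x * (prod p F - prod q F) + (p x - q x) * prod q F =
      prod p (insert x F) - prod q (insert x F)"
    using insert.hyps by (simp add: algebra_simps)
  finally show ?case using insert.hyps by simp
qed simp

lemma fps_eq_if_X_power_dvd:
  fixes F :: "int fps"
  assumes "\<And>n. fps_X ^ n dvd F - G"
  shows "F = G"
proof (rule fps_ext)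
  fix m
  from assms [of "Suc m"] obtain H where "F - G = fps_X ^ Suc m * H" by (auto elim: dvdE)
  then have "(F - G) $ m = 0" by (simp only: fps_X_power_mult_nth) simp
  then show "F $ m = G $ m" by simp
qed

lemma fps_X_dvd_iff_nth_0:
  fixes F :: "int fps"
  shows "fps_X dvd F \<longleftrightarrow> F $ 0 = 0"
proof
  assume "F $ 0 = 0"
  then have "F = fps_X * fps_shift 1 F"
    by (intro fps_ext) (auto simp: Suc_diff_1)
  then show "fps_X dvd F" by (rule dvdI)
qed (auto elim: dvdE)

text \<open>Two factors without constant term suffice for the right-hand sides to determine one more
  coefficient than the arguments do.\<close>

lemma product_system_unique:
  fixes P Q :: "'a \<Rightarrow> int fps" and k :: nat
  assumes "k \<ge> 2" and h: "h $ 0 = 0"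
    and sub: "\<And>a i. S a i \<subseteq> I"
    and P0: "\<And>a. a \<in> I \<Longrightarrow> P a $ 0 = 0" and Q0: "\<And>a. a \<in> I \<Longrightarrow> Q a $ 0 = 0"
    and P: "\<And>a. a \<in> I \<Longrightarrow> P a = (\<Prod>i<k. h + (\<Sum>b\<in>S a i. P b))"
    and Q: "\<And>a. a \<in> I \<Longrightarrow> Q a = (\<Prod>i<k. h + (\<Sum>b\<in>S a i. Q b))"
    and a: "a \<in> I"
  shows "P a = Q a"
proof (rule fps_eq_if_X_power_dvd)
  fix n
  show "fps_X ^ n dvd P a - Q a"
    using a
  proof (induction n arbitrary: a)
    case (Suc n)
    have "fps_X ^ (n + (card {..<k} - 1)) dvd
        (\<Prod>i<k. h + (\<Sum>b\<in>S a i. P b)) - (\<Prod>i<k. h + (\<Sum>b\<in>S a i. Q b))"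
    proof (rule fps_X_power_dvd_prod_diff)
      fix i
      show "fps_X dvd h + (\<Sum>b\<in>S a i. P b)" "fps_X dvd h + (\<Sum>b\<in>S a i. Q b)"
        using sub [of a i] P0 Q0 h
        by (auto simp: fps_X_dvd_iff_nth_0 fps_sum_nth intro!: sum.neutral)
      have "fps_X ^ n dvd (\<Sum>b\<in>S a i. P b - Q b)"
        using sub [of a i] Suc.IH by (intro dvd_sum) auto
      then show "fps_X ^ n dvd h + (\<Sum>b\<in>S a i. P b) - (h + (\<Sum>b\<in>S a i. Q b))"
        by (simp add: sum_subtractf)
    qed (use \<open>k \<ge> 2\<close> in \<open>auto simp: lessThan_empty_iff\<close>)
    then have "fps_X ^ (n + (k - 1)) dvd P a - Q a"
      using P [OF Suc.prems] Q [OF Suc.prems] by simp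
    moreover have "fps_X ^ Suc n dvd (fps_X ^ (n + (k - 1)) :: int fps)"
      using \<open>k \<ge> 2\<close> by (intro le_imp_power_dvd) simp
    ultimately show ?case by (rule dvd_trans [rotated])
  qed simp
qed

section \<open>The lacunary series\<close>

lemma lacunary_series_eq:
  assumes "k \<ge> 2"
  shows "lacunary_series k c = fps_X * (Abs_fps c oo fps_X ^ (k - 1))"
proof (rule fps_ext)
  fix m
  show "lacunary_series k c $ m = (fps_X * (Abs_fps c oo fps_X ^ (k - 1))) $ m"
  proof (cases m)
    case (Suc j)
    have "{n. (k - 1) * n + 1 = m} = (if k - 1 dvd j then {j div (k - 1)} else {})"
      using assms Suc by auto
    then show ?thesis
      using assms Suc by (simp add: lacunary_series_def fps_nth_compose_X_power)
  qed (simp add: lacunary_series_def)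
qed

text \<open>A sign \<open>e ^ n\<close> of the coefficients is absorbed into the substituted series.\<close>

lemma lacunary_series_signed:
  fixes e :: int
  assumes "k \<ge> 2"
  shows "lacunary_series k (\<lambda>n. e ^ n * c n) = fps_X * (Abs_fps c oo (fps_const e * fps_X ^ (k - 1)))"
proof -
  have "Abs_fps (\<lambda>n. e ^ n * c n) = Abs_fps c oo (fps_const e * fps_X)"
    by (simp add: fps_compose_linear)
  also have "\<dots> oo fps_X ^ (k - 1) = Abs_fps c oo ((fps_const e * fps_X) oo fps_X ^ (k - 1))"
    using assms by (intro fps_compose_assoc [symmetric]) auto
  also have "(fps_const e * fps_X) oo fps_X ^ (k - 1) = fps_const e * fps_X ^ (k - 1)"
    using assms by (simp add: fps_compose_mult_distrib)
  finally show ?thesis using assms by (simp add: lacunary_series_eq)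
qed

lemma trees_with_patterns_series:
  "Abs_fps (\<lambda>n. int (card (trees_with_patterns k I X n))) =
     gen_series internal_vertices (pattern_trees k I X)"
proof -
  have "trees_with_patterns k I X n = {t \<in> pattern_trees k I X. internal_vertices t = n}" for n
    by (auto simp: trees_with_patterns_def labelled_trees_def pattern_trees_def)
  then show ?thesis by (simp add: gen_series_def)
qed

lemma f_series_eq:
  assumes "k \<ge> 2"
  shows "f_series k I X =
    - (fps_X * (gen_series internal_vertices (pattern_trees k I X) oo - (fps_X ^ (k - 1))))"
proof -
  have "f_series k I X = - lacunary_series k (\<lambda>n. (-1) ^ n * int (card (trees_with_patterns k I X n)))"
    by (rule fps_ext) (simp add: f_series_def lacunary_series_def sum_negf)
  also have "\<dots> = - (fps_X * (gen_series internal_vertices (pattern_trees k I X) oo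
      (fps_const (-1) * fps_X ^ (k - 1))))"
    by (simp only: lacunary_series_signed [OF assms] trees_with_patterns_series)
  also have "fps_const (-1) * fps_X ^ (k - 1) = - (fps_X ^ (k - 1) :: int fps)"
    by (simp flip: fps_const_neg)
  finally show ?thesis .
qed

text \<open>The sign \<open>(-1) ^ ((k + 1) n)\<close> disappears when \<open>g\<close> is written in terms of \<open>- f\<close>, as
  \<open>(k + 1) + (k - 1)\<close> is even.\<close>

lemma g_series_compose_uminus:
  assumes k: "k \<ge> 2" and h: "h $ 0 = 0"
  shows "g_series k I Z oo - h =
    h * (gen_series internal_vertices (pattern_trees k I Z) oo h ^ (k - 1))"
proof -
  let ?G = "gen_series internal_vertices (pattern_trees k I Z)"
  let ?u = "fps_const ((-1) ^ (k + 1)) * fps_X ^ (k - 1) :: int fps"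
  have h': "(- h) $ 0 = 0" using h by simp
  have u0: "?u $ 0 = 0" using k by simp
  have "g_series k I Z = - (fps_X * (?G oo ?u))"
    by (simp only: g_series_def power_mult lacunary_series_signed [OF k] trees_with_patterns_series)
  then have "g_series k I Z oo - h = - ((fps_X oo - h) * (?G oo ?u oo - h))"
    by (simp only: fps_compose_uminus fps_compose_mult_distrib [OF h'])
  also have "fps_X oo - h = - h" using h' by (rule fps_X_fps_compose_startby0)
  also have "?G oo ?u oo - h = ?G oo (?u oo - h)"
    by (rule fps_compose_assoc [OF h' u0, symmetric])
  also have "?u oo - h = fps_const ((-1) ^ (k + 1)) * (- h) ^ (k - 1)"
    by (simp only: fps_compose_mult_distrib [OF h'] fps_const_compose
        fps_compose_power [OF h', symmetric] fps_X_fps_compose_startby0 [OF h'])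
  also have "\<dots> = h ^ (k - 1)"
  proof (cases "even k")
    case True
    then have "odd (k - 1)" using k by simp
    then show ?thesis using True by (simp add: power_minus_odd flip: fps_const_neg)
  next
    case False
    then show ?thesis by simp
  qed
  finally show ?thesis by simp
qed

section \<open>The inversion formula\<close>

lemma adjacent_pattern_in_labelled_trees:
  assumes "a \<in> I" "b \<in> I" "i < k"
  shows "adjacent_pattern a k i b k \<in> labelled_trees k 2 I"
proof -
  let ?ts = "(replicate k Leaf)[i := Node b (replicate k Leaf)]"
  have set: "set ?ts \<subseteq> {Leaf, Node b (replicate k Leaf)}"
    using set_update_subset_insert [of "replicate k Leaf" i "Node b (replicate k Leaf)"]
    by (auto simp: set_replicate_conv_if split: if_splits)
  have "sum_list (map internal_vertices ?ts) = 1"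
    using assms(3) by (simp add: map_update sum_list_update sum_list_replicate)
  moreover have "\<forall>t\<in>set ?ts. valence k t \<and> labels t \<subseteq> I"
    using set assms(2) by auto
  ultimately show ?thesis
    using assms(1) by (auto simp: adjacent_pattern_def labelled_trees_def)
qed

theorem theorem5p2:
  fixes k :: nat and I :: "'a set" and X Z :: "'a ltree set"
  assumes "k \<ge> 2"
    and "finite I"
    and "X \<subseteq> labelled_trees k 2 I"
    and "X \<union> Z = labelled_trees k 2 I"
    and "X \<inter> Z = {}"
  shows "fps_compose (g_series k I Z) (f_series k I X) = fps_X"
proof -
  \<comment> \<open>\<open>root_series\<close> counts vertices: substituting \<open>- t ^ (k - 1)\<close> for its variable and multiplying
    by \<open>t\<close> counts leaves instead, with sign \<open>(-1) ^ n\<close>. Thus \<open>hr a\<close> is \<open>h\<^sub>a\<close> and \<open>P a\<close> is \<open>G\<^sub>a(h)\<close>.\<close>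
  define u :: "int fps" where "u = - (fps_X ^ (k - 1))"
  define hr where "hr a = fps_X * (root_series k I X a oo u)" for a
  define h where "h = fps_X + (\<Sum>a\<in>I. hr a)"
  define P where "P a = h * (root_series k I Z a oo h ^ (k - 1))" for a
  have u0: "u $ 0 = 0" using assms(1) by (simp add: u_def)
  have h0: "h $ 0 = 0" by (simp add: h_def hr_def fps_sum_nth)
  have hk0: "(h ^ (k - 1)) $ 0 = 0" using assms(1) h0 by (simp add: fps_nth_power_0)
  have k: "x * x ^ (k - 1) = x ^ k" for x :: "int fps"
    using assms(1) by (simp flip: power_Suc)
  have prod_scale: "x ^ k * (\<Prod>i<k. y i) = (\<Prod>i<k. x * y i)" for x :: "int fps" and y
    by (simp add: prod.distrib)
  have f: "f_series k I X = - h"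
    by (simp add: f_series_eq [OF assms(1)] pattern_trees_series [OF assms(2)] fps_compose_add_distrib
        fps_compose_sum_distrib h_def hr_def u_def algebra_simps sum_distrib_left)
  have g: "g_series k I Z oo - h = h + (\<Sum>a\<in>I. P a)"
    by (simp add: g_series_compose_uminus [OF assms(1) h0] pattern_trees_series [OF assms(2)]
        fps_compose_add_distrib fps_compose_sum_distrib P_def algebra_simps sum_distrib_left)
  have hr_eq: "- hr a = (\<Prod>i<k. fps_X + (\<Sum>b\<in>child_labels k I X a i. hr b))" if "a \<in> I" for a
  proof -
    have "root_series k I X a oo u =
        u * (\<Prod>i<k. 1 + (\<Sum>b\<in>child_labels k I X a i. root_series k I X b oo u))"
      using u0
      by (subst root_series_eq [OF assms(2) that])
        (simp add: fps_compose_mult_distrib fps_compose_prod_distrib fps_compose_add_distrib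
          fps_compose_sum_distrib)
    then have "- hr a = fps_X * fps_X ^ (k - 1) *
        (\<Prod>i<k. 1 + (\<Sum>b\<in>child_labels k I X a i. root_series k I X b oo u))"
      by (simp add: hr_def u_def)
    also have "\<dots> = (\<Prod>i<k. fps_X * (1 + (\<Sum>b\<in>child_labels k I X a i. root_series k I X b oo u)))"
      by (simp only: k prod_scale)
    finally show ?thesis
      by (simp add: hr_def distrib_left sum_distrib_left)
  qed
  have P_eq: "P a = (\<Prod>i<k. h + (\<Sum>b\<in>child_labels k I Z a i. P b))" if "a \<in> I" for a
  proof -
    have "root_series k I Z a oo h ^ (k - 1) = h ^ (k - 1) *
        (\<Prod>i<k. 1 + (\<Sum>b\<in>child_labels k I Z a i. root_series k I Z b oo h ^ (k - 1)))"
      using hk0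
      by (subst root_series_eq [OF assms(2) that])
        (simp add: fps_compose_mult_distrib fps_compose_prod_distrib fps_compose_add_distrib
          fps_compose_sum_distrib)
    then have "P a = h * h ^ (k - 1) *
        (\<Prod>i<k. 1 + (\<Sum>b\<in>child_labels k I Z a i. root_series k I Z b oo h ^ (k - 1)))"
      by (simp add: P_def mult.assoc)
    also have "\<dots> =
        (\<Prod>i<k. h * (1 + (\<Sum>b\<in>child_labels k I Z a i. root_series k I Z b oo h ^ (k - 1))))"
      by (simp only: k prod_scale)
    finally show ?thesis
      by (simp add: P_def distrib_left sum_distrib_left)
  qed
  have split: "h + (\<Sum>b\<in>child_labels k I Z a i. - hr b) =
      fps_X + (\<Sum>b\<in>child_labels k I X a i. hr b)" if "a \<in> I" "i < k" for a i
  proof -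
    have "I = child_labels k I X a i \<union> child_labels k I Z a i"
      using adjacent_pattern_in_labelled_trees [OF that(1) _ that(2)] assms(4)
      by (auto simp: child_labels_def)
    moreover have "child_labels k I X a i \<inter> child_labels k I Z a i = {}"
      using assms(5) by (auto simp: child_labels_def)
    moreover have "finite (child_labels k I Y a i)" for Y
      using assms(2) by (simp add: child_labels_def)
    ultimately have "(\<Sum>b\<in>I. hr b) =
        (\<Sum>b\<in>child_labels k I X a i. hr b) + (\<Sum>b\<in>child_labels k I Z a i. hr b)"
      by (metis sum.union_disjoint)
    then show ?thesis by (simp add: h_def sum_negf)
  qed
  have "P a = - hr a" if "a \<in> I" for a
    using that
  proof (rule product_system_unique [OF assms(1) h0, rotated -1])
    show "- hr a = (\<Prod>i<k. h + (\<Sum>b\<in>child_labels k I Z a i. - hr b))" if "a \<in> I" for a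
      unfolding hr_eq [OF that] using split [OF that] by (intro prod.cong) auto
    show "P a = (\<Prod>i<k. h + (\<Sum>b\<in>child_labels k I Z a i. P b))" if "a \<in> I" for a
      using that by (rule P_eq)
  qed (auto simp: child_labels_def P_def hr_def h0)
  then have "h + (\<Sum>a\<in>I. P a) = fps_X"
    by (simp add: h_def sum_negf)
  then show ?thesis by (simp add: f g)
qed

end
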